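(* Let $h\ge 1$, $\lambda\in\mathbb{R}$ and $\mathbf{b}=\boldsymbol{\gamma}_h+\lambda\boldsymbol{\gamma}_0$. Assume: $\boldsymbol{\gamma}_0$ and $\boldsymbol{\gamma}_h$ are linearly independent; $\theta_{0b}>\theta_{0h}>0$; $\Gamma_0(0)>0$, $\Gamma_h(0)>0$, $\Gamma_b(0)>0$; and $\tau_h(0)>\tau_0(0)$. Let $\tau:=\tau_b(0)-\tau_h(0)$ and assume $\tau>0$ and $\tau\neq\tau_0(0)-\tau_h(0)$. Then $\lambda$ is determined by $\tau$ as $$\lambda=-\frac{\tau\,\Gamma_h(0)}{\bigl(\tau+\tau_h(0)-\tau_0(0)\bigr)\,\Gamma_0(0)}.$$
   Context: $(\gamma_k)_{k\in\mathbb{Z}}$ is a square-summable real sequence, $L\ge 1$ is an integer, and for each integer $h\ge 0$, $\boldsymbol{\gamma}_h:=(\gamma_h,\gamma_{h+1},\dots,\gamma_{h+L-1})'\in\mathbb{R}^L$. For nonzero vectors, $\theta_{0b}$ and $\theta_{0h}$ denote the angles between $\boldsymbol{\gamma}_0$ and $\mathbf{b}$, and between $\boldsymbol{\gamma}_0$ and $\boldsymbol{\gamma}_h$, respectively (in $[0,\pi]$). For a real filter $\mathbf{c}=(c_0,\dots,c_{L-1})'$ its transfer function is $\Gamma(\omega)=\sum_{k=0}^{L-1}c_k e^{-ik\omega}$; when $\Gamma(0)>0$, its phase $\Phi(\omega)$ is the continuous branch of $\arg\Gamma(\omega)$ near $\omega=0$ with $\Phi(0)=0$, and its time-shift at frequency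 zero is $\tau(0):=\lim_{\omega\to0}\Phi(\omega)/\omega=-\frac{\sum_{k=1}^{L-1}k c_k}{\sum_{k=0}^{L-1}c_k}$. The subscripts $0$, $h$, $b$ on $\Gamma$ and $\tau$ refer to the filters $\boldsymbol{\gamma}_0$, $\boldsymbol{\gamma}_h$, $\mathbf{b}$, respectively. *)

theory Defs
  imports "HOL-Analysis.Analysis" "Jordan_Normal_Form.VS_Connect"
begin

text \<open>Vectors of length L are elements of \<^term>\<open>carrier_vec L :: real vec set\<close>; their entries are
  indexed from 0, so entry k of a filter is its coefficient at lag k.\<close>

definition lag_vec :: "(int \<Rightarrow> real) \<Rightarrow> nat \<Rightarrow> nat \<Rightarrow> real vec" where
  "lag_vec \<gamma> L h = vec L (\<lambda>k. \<gamma> (int h + int k))"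

definition vec_length :: "real vec \<Rightarrow> real" where
  "vec_length v = sqrt (v \<bullet> v)"

text \<open>Meaningful for nonzero vectors of equal dimension only.\<close>

definition vec_angle :: "real vec \<Rightarrow> real vec \<Rightarrow> real" where
  "vec_angle v w = arccos ((v \<bullet> w) / (vec_length v * vec_length w))"

text \<open>Linear independence of the family \<open>(v, w)\<close>. The library's predicate is about the set
  \<open>{v, w}\<close>, which collapses when \<open>v = w\<close>.\<close>

definition lin_indep_pair :: "nat \<Rightarrow> real vec \<Rightarrow> real vec \<Rightarrow> bool" where
  "lin_indep_pair L v w \<longleftrightarrow>
     v \<noteq> w \<and> \<not> LinearCombinations.module.lin_dep class_ring (module_vec TYPE(real) L) {v, w}"

definition transfer_function :: "real vec \<Rightarrow> real \<Rightarrow> complex" where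
  "transfer_function c \<omega> =
     (\<Sum>k<dim_vec c. complex_of_real (c $ k) * exp (- (\<i> * of_nat k * complex_of_real \<omega>)))"

text \<open>The transfer function at frequency zero is the real number \<open>\<Sum>k. c\<^sub>k\<close>
  (see \<open>transfer_function_0\<close>), so taking the real part loses nothing.\<close>

definition gain0 :: "real vec \<Rightarrow> real" where
  "gain0 c = Re (transfer_function c 0)"

text \<open>A continuous branch of the argument of the transfer function near frequency zero,
  vanishing there.\<close>

definition is_phase :: "real vec \<Rightarrow> (real \<Rightarrow> real) \<Rightarrow> bool" where
  "is_phase c \<Phi> \<longleftrightarrow> \<Phi> 0 = 0 \<and>
     (\<exists>\<delta>>0. continuous_on {-\<delta><..<\<delta>} \<Phi> \<and>
        (\<forall>\<omega>\<in>{-\<delta><..<\<delta>}. transfer_function c \<omega> \<noteq> 0 \<and> is_Arg (transfer_function c \<omega>) (\<Phi> \<omega>)))"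

text \<open>The germ of the phase at zero is unique, and for positive gain at zero it exists
  (see \<open>is_phase_ex\<close> and \<open>is_phase_eq_Arg\<close>); the choice made by \<open>SOME\<close> is
  therefore irrelevant to the limit at zero.\<close>

definition phase :: "real vec \<Rightarrow> real \<Rightarrow> real" where
  "phase c = (SOME \<Phi>. is_phase c \<Phi>)"

definition time_shift :: "real vec \<Rightarrow> real" where
  "time_shift c = Lim (at 0) (\<lambda>\<omega>. phase c \<omega> / \<omega>)"

lemma transfer_function_0: "transfer_function c 0 = complex_of_real (\<Sum>k<dim_vec c. c $ k)"
  by (simp add: transfer_function_def)

lemma gain0_eq: "gain0 c = (\<Sum>k<dim_vec c. c $ k)"
  by (simp add: gain0_def transfer_function_0)

lemma transfer_function_0_gain0: "transfer_function c 0 = complex_of_real (gain0 c)"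
  by (simp add: gain0_eq transfer_function_0)

lemma transfer_function_has_derivative:
  "(transfer_function c has_vector_derivative
     (\<Sum>k<dim_vec c. complex_of_real (c $ k) * (- (\<i> * of_nat k)) *
        exp (- (\<i> * of_nat k * complex_of_real \<omega>)))) (at \<omega>)"
proof -
  have "((\<lambda>z. \<Sum>k<dim_vec c. complex_of_real (c $ k) * exp (- (\<i> * of_nat k * z)))
      has_field_derivative
     (\<Sum>k<dim_vec c. complex_of_real (c $ k) * (- (\<i> * of_nat k)) *
        exp (- (\<i> * of_nat k * complex_of_real \<omega>)))) (at (complex_of_real \<omega>))"
    by (rule DERIV_sum) (auto intro!: derivative_eq_intros)
  from has_vector_derivative_real_field[OF this]
  show ?thesis by (simp add: transfer_function_def[abs_def])
qed

lemma transfer_function_isCont: "isCont (transfer_function c) \<omega>"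
  using has_vector_derivative_continuous[OF transfer_function_has_derivative] by blast

lemma transfer_function_Re_pos:
  assumes "gain0 c > 0"
  shows "\<exists>\<delta>>0. \<forall>\<omega>\<in>{-\<delta><..<\<delta>}. Re (transfer_function c \<omega>) > 0"
proof -
  have "((\<lambda>\<omega>. Re (transfer_function c \<omega>)) \<longlongrightarrow> gain0 c) (at 0)"
    using transfer_function_isCont[of 0 c] unfolding isCont_def gain0_def
    by (intro tendsto_Re)
  hence "\<forall>\<^sub>F \<omega> in at 0. Re (transfer_function c \<omega>) > 0"
    using assms by (rule order_tendstoD)
  then obtain d where d: "d > 0" "\<And>x. x \<noteq> 0 \<Longrightarrow> dist x 0 < d \<Longrightarrow> Re (transfer_function c x) > 0"
    unfolding eventually_at by auto
  have "Re (transfer_function c x) > 0" if "x \<in> {-d<..<d}" for x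
    using that d(2)[of x] assms by (cases "x = 0") (auto simp: gain0_def dist_real_def)
  thus ?thesis using d(1) by blast
qed

lemma is_phase_ex:
  assumes "gain0 c > 0"
  shows "is_phase c (\<lambda>\<omega>. Arg (transfer_function c \<omega>))"
proof -
  obtain d where d: "d > 0" "\<forall>\<omega>\<in>{-d<..<d}. Re (transfer_function c \<omega>) > 0"
    using transfer_function_Re_pos[OF assms] by blast
  have nz: "transfer_function c w \<notin> \<real>\<^sub>\<le>\<^sub>0" "transfer_function c w \<noteq> 0" if "w \<in> {-d<..<d}" for w
    using d(2) that by (force simp: complex_nonpos_Reals_iff)+
  have "isCont (\<lambda>\<omega>. Arg (transfer_function c \<omega>)) w" if "w \<in> {-d<..<d}" for w
    using isCont_o2[OF transfer_function_isCont continuous_at_Arg[OF nz(1)[OF that]]] .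
  hence "continuous_on {-d<..<d} (\<lambda>\<omega>. Arg (transfer_function c \<omega>))"
    by (intro continuous_at_imp_continuous_on) auto
  moreover have "Arg (transfer_function c 0) = 0"
    using assms by (simp add: transfer_function_0_gain0)
  ultimately show ?thesis
    unfolding is_phase_def using d(1) nz Arg_eq by (auto simp: is_Arg_def)
qed

lemma is_phase_eq_Arg:
  assumes "is_phase c \<Phi>"
  shows "\<forall>\<^sub>F \<omega> in nhds 0. \<Phi> \<omega> = Arg (transfer_function c \<omega>)"
proof -
  from assms obtain d where d: "d > 0" "\<Phi> 0 = 0" "continuous_on {-d<..<d} \<Phi>"
    "\<And>w. w \<in> {-d<..<d} \<Longrightarrow> transfer_function c w \<noteq> 0 \<and> is_Arg (transfer_function c w) (\<Phi> w)"
    unfolding is_phase_def by blast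
  have "isCont \<Phi> 0"
    using d(1,3) by (simp add: continuous_on_eq_continuous_at)
  hence lim: "(\<Phi> \<longlongrightarrow> 0) (nhds 0)"
    using d(2) unfolding isCont_def by (metis tendsto_at_iff_tendsto_nhds)
  have "\<forall>\<^sub>F w in nhds 0. w \<in> {-d<..<d}"
    using d(1) by (intro eventually_nhds_in_open) auto
  moreover have "\<forall>\<^sub>F w in nhds 0. \<Phi> w > -pi" "\<forall>\<^sub>F w in nhds 0. \<Phi> w < pi"
    using order_tendstoD[OF lim] by auto
  ultimately show ?thesis
  proof eventually_elim
    case (elim w)
    have "Arg (transfer_function c w) = \<Phi> w"
      using d(4)[OF elim(1)] elim
      by (intro Arg_unique[of "cmod (transfer_function c w)"]) (auto simp: is_Arg_def)
    thus ?case by simp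
  qed
qed

lemma phase_ratio_tendsto:
  assumes g: "gain0 c > 0" and \<Phi>: "is_phase c \<Phi>"
  shows "((\<lambda>\<omega>. \<Phi> \<omega> / \<omega>) \<longlongrightarrow>
           - (\<Sum>k=1..<dim_vec c. real k * c $ k) / (\<Sum>k<dim_vec c. c $ k)) (at 0)"
proof -
  let ?S = "\<Sum>k<dim_vec c. real k * c $ k"
  let ?\<Gamma> = "transfer_function c"
  have "(?\<Gamma> has_vector_derivative - (\<i> * complex_of_real ?S)) (at 0)"
    using transfer_function_has_derivative[of c 0]
    by (simp add: sum_distrib_left sum_negf algebra_simps)
  moreover have "(Ln has_field_derivative inverse (?\<Gamma> 0)) (at (?\<Gamma> 0))"
    using g by (intro has_field_derivative_Ln) (simp add: transfer_function_0_gain0)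
  ultimately have "((Ln \<circ> ?\<Gamma>) has_vector_derivative - (\<i> * complex_of_real ?S) * inverse (?\<Gamma> 0)) (at 0)"
    by (intro field_vector_diff_chain_at)
  hence "((\<lambda>w. Im (Ln (?\<Gamma> w))) has_vector_derivative
     Im (- (\<i> * complex_of_real ?S) * inverse (?\<Gamma> 0))) (at 0)"
    unfolding o_def
    by (rule bounded_linear.has_vector_derivative[OF bounded_linear_Im])
  moreover have "Im (- (\<i> * complex_of_real ?S) * inverse (?\<Gamma> 0)) = - ?S / gain0 c"
    by (simp add: transfer_function_0_gain0 field_simps power2_eq_square)
  ultimately have "((\<lambda>w. Im (Ln (?\<Gamma> w))) has_field_derivative (- ?S / gain0 c)) (at 0)"
    by (simp add: has_real_derivative_iff_has_vector_derivative)
  moreover have "Im (Ln (?\<Gamma> 0)) = 0"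
    using g by (simp add: transfer_function_0_gain0 Ln_of_real)
  ultimately have "((\<lambda>w. Im (Ln (?\<Gamma> w)) / w) \<longlongrightarrow> - ?S / gain0 c) (at 0)"
    by (simp add: DERIV_def)
  moreover have "\<forall>\<^sub>F w in at 0. Im (Ln (?\<Gamma> w)) / w = \<Phi> w / w"
  proof -
    obtain d where d: "d > 0" "\<forall>\<omega>\<in>{-d<..<d}. Re (?\<Gamma> \<omega>) > 0"
      using transfer_function_Re_pos[OF g] by blast
    have "\<forall>\<^sub>F w in nhds 0. w \<in> {-d<..<d}"
      using d(1) by (intro eventually_nhds_in_open) auto
    with is_phase_eq_Arg[OF \<Phi>] have "\<forall>\<^sub>F w in nhds 0. Im (Ln (?\<Gamma> w)) / w = \<Phi> w / w"
    proof eventually_elim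
      case (elim w)
      hence "?\<Gamma> w \<noteq> 0" using d(2) by force
      thus ?case using elim by (simp add: Arg_eq_Im_Ln)
    qed
    thus ?thesis unfolding eventually_at_filter by (rule eventually_mono) auto
  qed
  ultimately have "((\<lambda>w. \<Phi> w / w) \<longlongrightarrow> - ?S / gain0 c) (at 0)"
    by (rule Lim_transform_eventually)
  moreover have "?S = (\<Sum>k=1..<dim_vec c. real k * c $ k)"
    by (rule sum.mono_neutral_right) (auto simp: not_le)
  ultimately show ?thesis by (simp add: gain0_eq)
qed

lemma time_shift_eq:
  assumes "gain0 c > 0"
  shows "time_shift c = - (\<Sum>k=1..<dim_vec c. real k * c $ k) / (\<Sum>k<dim_vec c. c $ k)"
proof -
  have "is_phase c (phase c)"
    unfolding phase_def by (rule someI[of "is_phase c", OF is_phase_ex[OF assms]])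
  from phase_ratio_tendsto[OF assms this] show ?thesis
    unfolding time_shift_def by (intro tendsto_Lim) auto
qed

end

theory Submission
  imports Defs
begin

text \<open>The product \<open>time_shift c * gain0 c\<close> is minus the first moment of the filter and is thus
  linear in \<open>c\<close>, as is the gain. Evaluating both on \<open>\<gamma>h + lam \<cdot>\<^sub>v \<gamma>0\<close> gives
  \<open>\<tau> * gain0 \<gamma>h + lam * (\<tau> + time_shift \<gamma>h - time_shift \<gamma>0) * gain0 \<gamma>0 = 0\<close>.\<close>

lemma gain0_add_smult:
  assumes "dim_vec v = dim_vec w"
  shows "gain0 (v + a \<cdot>\<^sub>v w) = gain0 v + a * gain0 w"
  using assms by (simp add: gain0_eq sum.distrib sum_distrib_left)

text \<open>Positive gain makes the denominator in \<open>time_shift_eq\<close> nonzero, so it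
  cancels.\<close>

lemma time_shift_times_gain0:
  assumes "gain0 c > 0"
  shows "time_shift c * gain0 c = - (\<Sum>k=1..<dim_vec c. real k * c $ k)"
proof -
  have "(\<Sum>k<dim_vec c. c $ k) \<noteq> 0"
    using assms by (simp add: gain0_eq)
  then show ?thesis
    unfolding time_shift_eq[OF assms] gain0_eq by simp
qed

text \<open>Positivity of all three gains turns each product into a first moment; the claim is then
  linearity of a finite sum.\<close>

lemma time_shift_times_gain0_add_smult:
  assumes "dim_vec v = dim_vec w" "gain0 v > 0" "gain0 w > 0" "gain0 (v + a \<cdot>\<^sub>v w) > 0"
  shows "time_shift (v + a \<cdot>\<^sub>v w) * gain0 (v + a \<cdot>\<^sub>v w)
    = time_shift v * gain0 v + a * (time_shift w * gain0 w)"
  unfolding assms(2-4)[THEN time_shift_times_gain0] using assms(1)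
  by (simp add: sum.distrib sum_distrib_left algebra_simps)

theorem theorem2:
  fixes \<gamma> :: "int \<Rightarrow> real" and L h :: nat and lam \<tau> :: real and \<gamma>0 \<gamma>h b :: "real vec"
  assumes "(\<lambda>k. (\<gamma> k)\<^sup>2) summable_on UNIV"
    and "L \<ge> 1"
    and "h \<ge> 1"
    and "\<gamma>0 = lag_vec \<gamma> L 0"
    and "\<gamma>h = lag_vec \<gamma> L h"
    and "b = \<gamma>h + lam \<cdot>\<^sub>v \<gamma>0"
    and "lin_indep_pair L \<gamma>0 \<gamma>h"
    and "vec_angle \<gamma>0 b > vec_angle \<gamma>0 \<gamma>h"
    and "vec_angle \<gamma>0 \<gamma>h > 0"
    and "gain0 \<gamma>0 > 0"
    and "gain0 \<gamma>h > 0"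
    and "gain0 b > 0"
    and "time_shift \<gamma>h > time_shift \<gamma>0"
    and "\<tau> = time_shift b - time_shift \<gamma>h"
    and "\<tau> > 0"
    and "\<tau> \<noteq> time_shift \<gamma>0 - time_shift \<gamma>h"
  shows "lam = - (\<tau> * gain0 \<gamma>h) / ((\<tau> + time_shift \<gamma>h - time_shift \<gamma>0) * gain0 \<gamma>0)"
proof -
  have dim: "dim_vec \<gamma>h = dim_vec \<gamma>0"
    by (simp add: assms(4,5) lag_vec_def)
  have gain: "gain0 b = gain0 \<gamma>h + lam * gain0 \<gamma>0"
    unfolding assms(6) by (rule gain0_add_smult[OF dim])
  have "time_shift b * gain0 b = time_shift \<gamma>h * gain0 \<gamma>h + lam * (time_shift \<gamma>0 * gain0 \<gamma>0)"
    using time_shift_times_gain0_add_smult[OF dim assms(11,10)] assms(12) unfolding assms(6) by blast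
  moreover have "time_shift b = \<tau> + time_shift \<gamma>h"
    using assms(14) by simp
  ultimately have "(\<tau> + time_shift \<gamma>h) * (gain0 \<gamma>h + lam * gain0 \<gamma>0)
      = time_shift \<gamma>h * gain0 \<gamma>h + lam * (time_shift \<gamma>0 * gain0 \<gamma>0)"
    by (simp add: gain)
  \<comment> \<open>The term \<open>time_shift \<gamma>h * gain0 \<gamma>h\<close> occurs on both
    sides and cancels, leaving an equation linear in \<open>lam\<close>.\<close>
  then have "lam * ((\<tau> + time_shift \<gamma>h - time_shift \<gamma>0) * gain0 \<gamma>0) = - (\<tau> * gain0 \<gamma>h)"
    by (simp add: algebra_simps)
  \<comment> \<open>The excluded value of \<open>\<tau>\<close> is exactly the zero of the first
    factor; the second is a positive gain.\<close>
  moreover have "(\<tau> + time_shift \<gamma>h - time_shift \<gamma>0) * gain0 \<gamma>0 \<noteq> 0"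
    using assms(10,16) by simp
  ultimately show ?thesis
    by (metis nonzero_mult_div_cancel_right)
qed

end
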